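(* Let $p$ be an odd prime and $t=(p-1)/2$. The actions $K_i$ on the $p$-bar cores correspond to the reflections $r_{\alpha_i}$ in the simple roots: for every $p$-bar core $\rho$ and every $i\in\{0,1,\dots,t\}$, if $\mathrm{wt}(\rho)=\Lambda_0-\sum_{j=0}^t\gamma_j(\rho)\alpha_j$ denotes the weight of $\rho$, then $$\mathrm{wt}(K_i(\rho))=r_{\alpha_i}(\mathrm{wt}(\rho)).$$
   Context: Let $p$ be an odd prime, $t=(p-1)/2$. A partition with distinct parts is put on an abacus with runners $0,\dots,p-1$; a part $ap+b$ ($0\le b<p$) is a bead on runner $b$ at height $a$. A $p$-bar core is a strict partition with no part divisible by $p$, having beads on at most one of the runners $j,p-j$ for each $j$, and with the beads on each runner occupying heights $0,1,2,\dots$ without gaps. Its core $t$-tuple is $((\ell_1,\epsilon_1),\dots,(\ell_t,\epsilon_t))$, where $\ell_j$ is the number of beads on runner $j$ or $p-j$, and $\epsilon_j=0$ if there are beads on runner $j$, $\epsilon_j=1$ otherwise. Scopes involutions $K_i$: for $0<i<t$, $K_i$ interchanges the beads on runners $i$ and $i+1$ (keeping heights) and the beads on runners $p-i$ and $p-i-1$; $K_t$ interchanges the beads on runners $t$ and $t+1$; $K_0$ interchanges each part $ap+1$ with $a\ge1$ with the part $ap-1$ (i.e. replaces every part $ap+1$, $a\geq 1$, by $ap-1$ and every part $ap-1$ by $ap+1$), and removes the part $1$ if it is present, adds it if it is absent. All other parts are fixed. Content: fill each row of the Young diagram of $\rho$ from left to right with repetitions of the length-$p$ sequence $0,1,\dots,t-1,t,t-1,\dots,1,0$;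 $\gamma_j(\rho)$ is the number of boxes containing $j$. Lie-theoretic data (type $A^{(2)}_{2t}$): $\alpha_0,\dots,\alpha_t$ are the simple roots, with symmetric bilinear form $(\alpha_0,\alpha_0)=1$, $(\alpha_i,\alpha_i)=2$ for $0<i<t$, $(\alpha_t,\alpha_t)=4$, and, if $t\ge2$, $(\alpha_i,\alpha_{i+1})=-1$ for $0\le i<t-1$ and $(\alpha_{t-1},\alpha_t)=-2$; if $t=1$, $(\alpha_0,\alpha_1)=-2$; all other products of distinct simple roots are $0$. $\Lambda_0$ is the fundamental weight dual to the coroot $h_0$: $2(\Lambda_0,\alpha_i)/(\alpha_i,\alpha_i)$ equals $1$ for $i=0$ and $0$ for $i>0$. The $\alpha_i$ and $\Lambda_0$ are linearly independent, and $r_\alpha(\lambda)=\lambda-2\frac{(\lambda,\alpha)}{(\alpha,\alpha)}\alpha$. *)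

theory Defs
  imports Complex_Main "HOL-Computational_Algebra.Primes" "HOL-Combinatorics.Transposition"
begin

text \<open>A strict partition is encoded by the set of its (positive, pairwise distinct) parts.\<close>

definition strict_partition :: "nat set \<Rightarrow> bool" where
  "strict_partition \<rho> \<longleftrightarrow> finite \<rho> \<and> 0 \<notin> \<rho>"

text \<open>The heights of the beads on runner \<open>b\<close> of the abacus with \<open>p\<close> runners (used for \<open>b < p\<close>).\<close>

definition runner :: "nat \<Rightarrow> nat set \<Rightarrow> nat \<Rightarrow> nat set" where
  "runner p \<rho> b = {a. a * p + b \<in> \<rho>}"

definition bar_core :: "nat \<Rightarrow> nat set \<Rightarrow> bool" where
  "bar_core p \<rho> \<longleftrightarrow>
     strict_partition \<rho> \<and>
     (\<forall>x\<in>\<rho>. \<not> p dvd x) \<and>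
     (\<forall>j. 1 \<le> j \<and> j < p \<longrightarrow> runner p \<rho> j = {} \<or> runner p \<rho> (p - j) = {}) \<and>
     (\<forall>b<p. \<exists>n. runner p \<rho> b = {..<n})"

text \<open>Every bead is moved from its runner \<open>b\<close> to the runner \<open>\<sigma> b\<close>, at the same height.\<close>

definition permute_runners :: "nat \<Rightarrow> (nat \<Rightarrow> nat) \<Rightarrow> nat set \<Rightarrow> nat set" where
  "permute_runners p \<sigma> \<rho> = {a * p + \<sigma> b | a b. b < p \<and> a * p + b \<in> \<rho>}"

text \<open>The involution \<open>K\<^sub>i\<close>, for \<open>p = 2 * t + 1\<close>; it is only meaningful for \<open>i \<le> t\<close>, so that the
  last case is \<open>i = t\<close>.\<close>

definition scopes :: "nat \<Rightarrow> nat \<Rightarrow> nat \<Rightarrow> nat set \<Rightarrow> nat set" where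
  "scopes p t i \<rho> =
     (if i = 0 then
        {a * p - 1 | a. 1 \<le> a \<and> a * p + 1 \<in> \<rho>} \<union>
        {a * p + 1 | a. 1 \<le> a \<and> a * p - 1 \<in> \<rho>} \<union>
        (if 1 \<in> \<rho> then {} else {1}) \<union>
        {x \<in> \<rho>. x mod p \<noteq> 1 \<and> x mod p \<noteq> p - 1}
      else if i < t then
        permute_runners p (transpose i (i + 1) \<circ> transpose (p - i) (p - i - 1)) \<rho>
      else permute_runners p (transpose t (t + 1)) \<rho>)"

definition residue_seq :: "nat \<Rightarrow> nat list" where
  "residue_seq t = [0..<t] @ [t] @ rev [0..<t]"

text \<open>As the parts of \<open>\<rho>\<close> are distinct, the rows of its Young diagram are indexed by the parts:
  \<open>(x, c)\<close> is the box in the row of length \<open>x\<close> and in column \<open>c\<close>, columns being counted from 0.\<close>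

definition young_diagram :: "nat set \<Rightarrow> (nat \<times> nat) set" where
  "young_diagram \<rho> = {(x, c). x \<in> \<rho> \<and> c < x}"

definition content :: "nat \<Rightarrow> nat \<Rightarrow> nat set \<Rightarrow> nat \<Rightarrow> nat" where
  "content p t \<rho> j = card {(x, c) \<in> young_diagram \<rho>. residue_seq t ! (c mod p) = j}"

text \<open>Simple roots \<open>\<alpha> 0, \<dots>, \<alpha> t\<close> and fundamental weight \<open>\<Lambda>\<close> (that is, \<open>\<Lambda>\<^sub>0\<close>) of type
  \<open>A\<^sup>(\<^sup>2\<^sup>)\<^bsub>2t\<^esub>\<close>, in a vector space with a symmetric bilinear form. The value
  \<open>form \<Lambda> \<Lambda>\<close> is left unconstrained.\<close>

locale twisted_affine_A2 = vector_space scale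
  for scale :: "'k::field_char_0 \<Rightarrow> 'v::ab_group_add \<Rightarrow> 'v" +
  fixes form :: "'v \<Rightarrow> 'v \<Rightarrow> 'k"
    and t :: nat
    and \<alpha> :: "nat \<Rightarrow> 'v"
    and \<Lambda> :: 'v
  assumes form_sym: "form u v = form v u"
    and form_add: "form (u + v) w = form u w + form v w"
    and form_scale: "form (scale c u) w = c * form u w"
    and inj_roots: "inj_on \<alpha> {0..t}"
    and weight_not_root: "\<Lambda> \<notin> \<alpha> ` {0..t}"
    and independent: "independent (insert \<Lambda> (\<alpha> ` {0..t}))"
    and form_0: "form (\<alpha> 0) (\<alpha> 0) = 1"
    and form_mid: "0 < i \<Longrightarrow> i < t \<Longrightarrow> form (\<alpha> i) (\<alpha> i) = 2"
    and form_t: "form (\<alpha> t) (\<alpha> t) = 4"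
    and form_adjacent: "2 \<le> t \<Longrightarrow> i < t - 1 \<Longrightarrow> form (\<alpha> i) (\<alpha> (i + 1)) = -1"
    and form_last: "2 \<le> t \<Longrightarrow> form (\<alpha> (t - 1)) (\<alpha> t) = -2"
    and form_rank_one: "t = 1 \<Longrightarrow> form (\<alpha> 0) (\<alpha> 1) = -2"
    and form_far: "i + 1 < j \<Longrightarrow> j \<le> t \<Longrightarrow> form (\<alpha> i) (\<alpha> j) = 0"
    and form_weight:
      "i \<le> t \<Longrightarrow> 2 * form \<Lambda> (\<alpha> i) / form (\<alpha> i) (\<alpha> i) = (if i = 0 then 1 else 0)"

definition reflection ::
  "('k::field_char_0 \<Rightarrow> 'v::ab_group_add \<Rightarrow> 'v) \<Rightarrow> ('v \<Rightarrow> 'v \<Rightarrow> 'k) \<Rightarrow> 'v \<Rightarrow> 'v \<Rightarrow> 'v" where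
  "reflection scale form \<beta> v = v - scale (2 * form v \<beta> / form \<beta> \<beta>) \<beta>"

definition weight ::
  "('k::field_char_0 \<Rightarrow> 'v::ab_group_add \<Rightarrow> 'v) \<Rightarrow> (nat \<Rightarrow> 'v) \<Rightarrow> 'v \<Rightarrow> nat \<Rightarrow> nat \<Rightarrow> nat set \<Rightarrow> 'v" where
  "weight scale \<alpha> \<Lambda> p t \<rho> = \<Lambda> - (\<Sum>j=0..t. scale (of_nat (content p t \<rho> j)) (\<alpha> j))"

end

theory Submission
  imports Defs
begin

text \<open>Each row of length \<open>x\<close> contributes the sum \<open>\<beta>(x)\<close> of the simple roots labelling its boxes. A
  full period of the labelling contributes the null root, so the pairing of \<open>\<beta>(x)\<close> with the coroot
  \<open>h\<^sub>i\<close> only depends on \<open>x mod p\<close>, and it vanishes except for the rows moved by \<open>K\<^sub>i\<close>, where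
  it counts the \<open>i\<close>-boxes gained or lost. So \<open>K\<^sub>i\<close> and the reflection agree row by row. The one
  exception is the part \<open>1\<close>, with \<open>\<beta>(1) = \<alpha>\<^sub>0\<close>: adding or removing it compensates for the
  shift of \<open>\<Lambda>\<^sub>0\<close> by \<open>\<alpha>\<^sub>0\<close> under the reflection \<open>r\<^sub>0\<close>.\<close>

section \<open>Labels of the boxes in a row\<close>

text \<open>The sequence is a palindrome climbing to \<open>t\<close> in the middle, so a label is
  the distance to the nearer end.\<close>

lemma residue_seq_nth:
  assumes "b \<le> 2 * t"
  shows "residue_seq t ! b = min b (2 * t - b)"
proof -
  consider "b < t" | "b = t" | "t < b"
    by linarith
  then show ?thesis
    using assms by cases (auto simp: residue_seq_def nth_append rev_nth nth_Cons split: nat.split)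
qed

lemma residue_seq_nth_le:
  assumes "b \<le> 2 * t"
  shows "residue_seq t ! b \<le> t"
  using assms by (auto simp: residue_seq_nth min_def)

section \<open>Runner permutations as maps on parts\<close>

definition move_part :: "nat \<Rightarrow> (nat \<Rightarrow> nat) \<Rightarrow> nat \<Rightarrow> nat" where
  "move_part p \<sigma> x = x div p * p + \<sigma> (x mod p)"

text \<open>Expressing the new parts as the image of a function makes it possible to reindex sums
  over parts.\<close>

lemma permute_runners_eq_image:
  assumes "0 < p"
  shows "permute_runners p \<sigma> \<rho> = move_part p \<sigma> ` \<rho>"
proof (intro equalityI subsetI)
  fix y assume "y \<in> permute_runners p \<sigma> \<rho>"
  then obtain a b where "y = a * p + \<sigma> b" "b < p" "a * p + b \<in> \<rho>"
    by (auto simp: permute_runners_def)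
  then show "y \<in> move_part p \<sigma> ` \<rho>"
    by (intro image_eqI[of _ _ "a * p + b"]) (auto simp: move_part_def)
next
  fix y assume "y \<in> move_part p \<sigma> ` \<rho>"
  then obtain x where "x \<in> \<rho>" "y = move_part p \<sigma> x"
    by auto
  then show "y \<in> permute_runners p \<sigma> \<rho>"
    unfolding permute_runners_def move_part_def using assms
    by (intro CollectI exI[of _ "x div p"] exI[of _ "x mod p"]) auto
qed

text \<open>As \<open>\<sigma>\<close> sends residues to residues, the height and the value of
  \<open>\<sigma>\<close> at the runner can be read off the moved part.\<close>

lemma inj_move_part:
  assumes "0 < p" "inj \<sigma>" "\<And>b. b < p \<Longrightarrow> \<sigma> b < p"
  shows "inj_on (move_part p \<sigma>) A"
proof (rule inj_onI)
  fix x y assume eq: "move_part p \<sigma> x = move_part p \<sigma> y"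
  have dm: "move_part p \<sigma> z div p = z div p" "move_part p \<sigma> z mod p = \<sigma> (z mod p)" for z
    using assms(1) assms(3)[of "z mod p"] by (auto simp: move_part_def)
  have "x div p = y div p"
    by (metis dm(1) eq)
  moreover have "\<sigma> (x mod p) = \<sigma> (y mod p)"
    by (metis dm(2) eq)
  then have "x mod p = y mod p"
    by (rule injD[OF assms(2)])
  ultimately show "x = y"
    by (metis div_mult_mod_eq)
qed

section \<open>The involution K_0 as a map on parts\<close>

text \<open>The part \<open>1\<close> is held fixed here: its mirror image around 0 is not a part,
  and K_0 adds or removes it separately.\<close>

definition swap_around_multiples :: "nat \<Rightarrow> nat \<Rightarrow> nat" where
  "swap_around_multiples p x =
     (if x mod p = p - 1 then x + 2 else if x mod p = 1 \<and> x \<noteq> 1 then x - 2 else x)"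

lemma mod_eq_pred_iff:
  assumes "2 < (p :: nat)"
  shows "x mod p = p - 1 \<longleftrightarrow> (\<exists>a\<ge>1. x = a * p - 1)"
proof
  assume *: "x mod p = p - 1"
  have "x = x div p * p + (p - 1)"
    using * by (metis div_mult_mod_eq)
  \<comment> \<open>The residue \<open>p - 1\<close> lies just below the next multiple of
    \<open>p\<close>, so the height is one less than the witness \<open>a\<close>.\<close>
  then have "x = Suc (x div p) * p - 1"
    using assms by (auto simp: algebra_simps)
  then show "\<exists>a\<ge>1. x = a * p - 1"
    by (intro exI[of _ "Suc (x div p)"]) auto
next
  assume "\<exists>a\<ge>1. x = a * p - 1"
  then obtain a where "x = a * p - 1" "1 \<le> a"
    by blast
  then have "x = (a - 1) * p + (p - 1)"
    using assms by (cases a) auto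
  then show "x mod p = p - 1"
    using assms by (simp only: mod_mult_self3) simp
qed

lemma mod_eq_one_iff:
  assumes "2 < (p :: nat)"
  shows "x mod p = 1 \<and> x \<noteq> 1 \<longleftrightarrow> (\<exists>a\<ge>1. x = a * p + 1)"
proof
  assume *: "x mod p = 1 \<and> x \<noteq> 1"
  then have "x = x div p * p + 1"
    by (metis div_mult_mod_eq)
  moreover have "1 \<le> x div p"
    using * calculation by (cases "x div p") auto
  ultimately show "\<exists>a\<ge>1. x = a * p + 1"
    by blast
next
  assume "\<exists>a\<ge>1. x = a * p + 1"
  then obtain a where a: "1 \<le> a" "x = a * p + 1"
    by blast
  have "x mod p = 1"
    unfolding a(2) mod_mult_self3 using assms by simp
  then show "x mod p = 1 \<and> x \<noteq> 1"
    using a assms by simp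
qed

lemma swap_around_multiples_simps:
  assumes "2 < p" "1 \<le> a"
  shows "swap_around_multiples p (a * p - 1) = a * p + 1"
    and "swap_around_multiples p (a * p + 1) = a * p - 1"
proof -
  have "2 < a * p"
    using assms by (cases a) auto
  moreover have "(a * p - 1) mod p = p - 1"
    using mod_eq_pred_iff assms by blast
  moreover have "(a * p + 1) mod p = 1"
    unfolding mod_mult_self3 using assms by simp
  ultimately show "swap_around_multiples p (a * p - 1) = a * p + 1"
    "swap_around_multiples p (a * p + 1) = a * p - 1"
    using assms by (auto simp: swap_around_multiples_def)
qed

lemma swap_around_multiples_involution:
  assumes "2 < p"
  shows "swap_around_multiples p (swap_around_multiples p x) = x"
proof -
  consider a where "1 \<le> a" "x = a * p - 1" | a where "1 \<le> a" "x = a * p + 1"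
    | "x mod p \<noteq> p - 1" "\<not> (x mod p = 1 \<and> x \<noteq> 1)"
    using mod_eq_pred_iff[OF assms, of x] mod_eq_one_iff[OF assms, of x] by blast
  then show ?thesis
  proof cases
    case 3
    then show ?thesis
      by (auto simp: swap_around_multiples_def)
  qed (auto simp only: swap_around_multiples_simps[OF assms])
qed

lemma inj_swap_around_multiples:
  assumes "2 < p"
  shows "inj_on (swap_around_multiples p) A"
  using swap_around_multiples_involution[OF assms] by (rule inj_on_inverseI)

text \<open>The clauses of \<open>scopes\<close> that come from existing parts are the images of
  three residue classes: 1, \<open>p - 1\<close>, and the rest, which is fixed.\<close>

lemma scopes_0_eq:
  assumes "2 < p"
  shows "scopes p t 0 \<rho> =
    swap_around_multiples p ` (\<rho> - {1}) \<union> (if 1 \<in> \<rho> then {} else {1})"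
proof -
  let ?s = "swap_around_multiples p"
  \<comment> \<open>Because \<open>2 < p\<close>, the part \<open>1\<close> has residue 1, distinct
    from \<open>p - 1\<close>, and so lies in none of the three classes.\<close>
  have split: "\<rho> - {1} = {x \<in> \<rho>. x mod p = 1 \<and> x \<noteq> 1} \<union> {x \<in> \<rho>. x mod p = p - 1}
      \<union> {x \<in> \<rho>. x mod p \<noteq> 1 \<and> x mod p \<noteq> p - 1}"
    using assms by auto
  have 1: "?s ` {x \<in> \<rho>. x mod p = 1 \<and> x \<noteq> 1} = {a * p - 1 | a. 1 \<le> a \<and> a * p + 1 \<in> \<rho>}"
    (is "?l = ?r")
  proof (intro equalityI subsetI)
    fix y assume "y \<in> ?l"
    then obtain x a where xa: "y = ?s x" "x \<in> \<rho>" "1 \<le> a" "x = a * p + 1"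
      using mod_eq_one_iff[OF assms] by blast
    then have "y = a * p - 1" "a * p + 1 \<in> \<rho>"
      using swap_around_multiples_simps(2)[OF assms xa(3)] by simp_all
    then show "y \<in> ?r"
      using xa(3) by blast
  next
    fix y assume "y \<in> ?r"
    then obtain a where a: "y = a * p - 1" "1 \<le> a" "a * p + 1 \<in> \<rho>"
      by blast
    have "a * p + 1 \<in> {x \<in> \<rho>. x mod p = 1 \<and> x \<noteq> 1}"
      using a mod_eq_one_iff[OF assms, of "a * p + 1"] by blast
    then have "?s (a * p + 1) \<in> ?l"
      by (rule imageI)
    then show "y \<in> ?l"
      unfolding a(1) swap_around_multiples_simps(2)[OF assms a(2)] .
  qed
  have 2: "?s ` {x \<in> \<rho>. x mod p = p - 1} = {a * p + 1 | a. 1 \<le> a \<and> a * p - 1 \<in> \<rho>}"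
    (is "?l = ?r")
  proof (intro equalityI subsetI)
    fix y assume "y \<in> ?l"
    then obtain x a where xa: "y = ?s x" "x \<in> \<rho>" "1 \<le> a" "x = a * p - 1"
      using mod_eq_pred_iff[OF assms] by blast
    then have "y = a * p + 1" "a * p - 1 \<in> \<rho>"
      using swap_around_multiples_simps(1)[OF assms xa(3)] by simp_all
    then show "y \<in> ?r"
      using xa(3) by blast
  next
    fix y assume "y \<in> ?r"
    then obtain a where a: "y = a * p + 1" "1 \<le> a" "a * p - 1 \<in> \<rho>"
      by blast
    have "a * p - 1 \<in> {x \<in> \<rho>. x mod p = p - 1}"
      using a mod_eq_pred_iff[OF assms, of "a * p - 1"] by blast
    then have "?s (a * p - 1) \<in> ?l"
      by (rule imageI)
    then show "y \<in> ?l"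
      unfolding a(1) swap_around_multiples_simps(1)[OF assms a(2)] .
  qed
  have 3: "?s ` {x \<in> \<rho>. x mod p \<noteq> 1 \<and> x mod p \<noteq> p - 1} = {x \<in> \<rho>. x mod p \<noteq> 1 \<and> x mod p \<noteq> p - 1}"
    by (auto simp: swap_around_multiples_def image_iff)
  show ?thesis
    unfolding split image_Un 1 2 3 scopes_def if_P[OF refl] by (simp only: Un_ac)
qed

section \<open>Simple reflections and coroot pairings\<close>

context twisted_affine_A2
begin

text \<open>For \<open>t = 0\<close> the only simple root would have squared length both 1 and
  4.\<close>

lemma rank_pos: "0 < t"
  using form_0 form_t by (cases t) auto

abbreviation reflect :: "nat \<Rightarrow> 'v \<Rightarrow> 'v" where
  "reflect i \<equiv> reflection scale form (\<alpha> i)"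

lemma reflect_add: "reflect i (u + v) = reflect i u + reflect i v"
  by (simp add: reflection_def form_add scale_left_distrib add_divide_distrib distrib_left)

lemma reflect_0: "reflect i 0 = 0"
  using reflect_add[of i 0 0] by simp

lemma reflect_sum: "reflect i (sum f A) = (\<Sum>x\<in>A. reflect i (f x))"
  by (induction A rule: infinite_finite_induct) (simp_all add: reflect_0 reflect_add)

lemma reflect_diff: "reflect i (u - v) = reflect i u - reflect i v"
  using reflect_add[of i "u - v" v] by (simp add: algebra_simps)

lemma reflect_fundamental_weight:
  assumes "i \<le> t"
  shows "reflect i \<Lambda> = (if i = 0 then \<Lambda> - \<alpha> 0 else \<Lambda>)"
  using form_weight[OF assms] by (simp add: reflection_def)

text \<open>The value of \<open>v\<close> on the coroot h_i; on simple roots these values are the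
  Cartan matrix entries.\<close>

definition pairing :: "'v \<Rightarrow> nat \<Rightarrow> 'k" where
  "pairing v i = 2 * form v (\<alpha> i) / form (\<alpha> i) (\<alpha> i)"

lemma pairing_add: "pairing (u + v) i = pairing u i + pairing v i"
  by (simp add: pairing_def form_add add_divide_distrib distrib_left)

lemma pairing_0: "pairing 0 i = 0"
  using pairing_add[of 0 0 i] by simp

text \<open>In rank one the neighbour of the shortest root is already the longest one, which turns
  the entry -2 into -4.\<close>

lemma pairing_root_0:
  assumes "j \<le> t"
  shows "pairing (\<alpha> j) 0 = (if j = 0 then 2 else if j = 1 then if t = 1 then -4 else -2 else 0)"
proof -
  consider "j = 0" | "j = 1" "t = 1" | "j = 1" "2 \<le> t" | "2 \<le> j"
    using assms by linarith
  then show ?thesis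
    using form_adjacent[of 0] form_far[of 0 j] assms form_0 form_rank_one
      form_sym[of "\<alpha> j" "\<alpha> 0"]
    by cases (simp_all add: pairing_def)
qed

text \<open>The exceptional entry -2 occurs at \<open>i = t - 1\<close>, \<open>j = t\<close>: there
  the form is -2 while \<alpha>_i has squared length 2.\<close>

lemma pairing_root_pos:
  assumes "j \<le> t" "i \<le> t" "0 < i"
  shows "pairing (\<alpha> j) i =
    (if j = i then 2 else if j = i + 1 then if j = t then -2 else -1
     else if j + 1 = i then -1 else 0)"
proof -
  consider "j = i" | "j = i + 1" "j = t" | "j = i + 1" "j < t" | "j + 1 = i" "i = t" "t = 1"
    | "j + 1 = i" "i = t" "2 \<le> t" | "j + 1 = i" "i < t" | "i + 1 < j" | "j + 1 < i"
    using assms by linarith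
  then show ?thesis
  proof cases
    case 1
    then show ?thesis
      using form_mid[of i] form_t assms by (cases "i = t") (auto simp: pairing_def)
  next
    case 2
    then show ?thesis
      using form_mid[of i] form_last form_sym[of "\<alpha> j"] assms by (auto simp: pairing_def)
  next
    case 3
    then show ?thesis
      using form_mid[of i] form_adjacent[of i] form_sym[of "\<alpha> j"] assms by (auto simp: pairing_def)
  next
    case 4
    then have "i = 1" "j = 0"
      by simp_all
    then show ?thesis
      using 4 form_t form_rank_one by (auto simp: pairing_def)
  next
    case 5
    then show ?thesis
      using form_t form_last assms by (auto simp: pairing_def)
  next
    case 6
    then show ?thesis
      using form_mid[of i] form_adjacent[of j] assms by (auto simp: pairing_def)
  next
    case 7
    then show ?thesis
      using form_far[of i j] form_sym[of "\<alpha> j"] assms by (auto simp: pairing_def)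
  next
    case 8
    then show ?thesis
      using form_far[of j i] assms by (auto simp: pairing_def)
  qed
qed

section \<open>Roots of rows and their pairings\<close>

definition box_root :: "nat \<Rightarrow> 'v" where
  "box_root c = \<alpha> (residue_seq t ! (c mod (2 * t + 1)))"

text \<open>This is the sum \<beta>(x) attached to a row of length \<open>x\<close>.\<close>

definition row_root :: "nat \<Rightarrow> 'v" where
  "row_root x = (\<Sum>c<x. box_root c)"

lemma row_root_Suc: "row_root (Suc x) = row_root x + box_root x"
  by (simp add: row_root_def)

lemma box_root_eq:
  "box_root c = \<alpha> (min (c mod (2 * t + 1)) (2 * t - c mod (2 * t + 1)))"
proof -
  have "c mod (2 * t + 1) < 2 * t + 1"
    by (rule mod_less_divisor) simp
  then show ?thesis
    by (simp add: box_root_def residue_seq_nth)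
qed

text \<open>For positive \<open>i\<close>, the value -1 means that the next box of the row is
  labelled \<open>i\<close>, and 1 that the last one is. For \<open>i = 0\<close> the two adjacent
  boxes labelled 0 around a multiple of \<open>p\<close> move together, whence 2 and -2; a row
  ending between them has value 0.\<close>

definition row_pairing :: "nat \<Rightarrow> nat \<Rightarrow> 'k" where
  "row_pairing i b =
     (if i = 0 then if b = 1 then 2 else if b = 2 * t then -2 else 0
      else if b = i \<or> b = 2 * t - i then -1
      else if b = i + 1 \<or> b = 2 * t + 1 - i then 1 else 0)"

text \<open>The increments of the closed form around the cycle of residues are Cartan entries.
  Returning to its initial value at the wrap-around expresses that a full period pairs to
  zero.\<close>

lemma row_pairing_Suc:
  assumes "b \<le> 2 * t" "i \<le> t"
  shows "row_pairing i (if b = 2 * t then 0 else Suc b) =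
    row_pairing i b + pairing (\<alpha> (min b (2 * t - b))) i"
proof (cases "i = 0")
  case True
  then show ?thesis
    using assms rank_pos by (auto simp: pairing_root_0 row_pairing_def min_def)
next
  case False
  then have i: "0 < i"
    by simp
  \<comment> \<open>Substituting \<open>t = i + d\<close> removes the truncated
    subtractions.\<close>
  obtain d where d: "t = i + d"
    using assms le_Suc_ex by blast
  have q: "2 * t - i = i + 2 * d" "2 * t + 1 - i = Suc (i + 2 * d)"
    using d by simp_all
  show ?thesis
  \<comment> \<open>Labels rise up to \<open>b = t\<close> and fall afterwards. The label
    \<open>t\<close> occurs once per period, so for \<open>i = t - 1\<close> the value jumps there
    from 1 to -1, matching the entry -2.\<close>
  proof (cases "b \<le> t")
    case True
    then have m: "min b (2 * t - b) = b" "b \<noteq> 2 * t"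
      using rank_pos by simp_all
    consider "b + 1 < i" | "b + 1 = i" | "b = i" | "b = i + 1" | "i + 1 < b"
      by linarith
    then show ?thesis
      unfolding m(1) pairing_root_pos[OF True assms(2) i] if_not_P[OF m(2)] row_pairing_def q
      using True d i by cases simp_all
  next
    case False
    define j where "j = 2 * t - b"
    have m: "min b (2 * t - b) = j" "j < t" "b + j = 2 * t"
      using False assms by (simp_all add: j_def)
    consider "j + 1 < i" | "j + 1 = i" | "j = i" | "j = i + 1" | "i + 1 < j"
      by linarith
    then show ?thesis
      unfolding m(1) pairing_root_pos[OF less_imp_le[OF m(2)] assms(2) i] row_pairing_def q
      using False d i m(2,3) by cases simp_all
  qed
qed

lemma pairing_row_root:
  assumes "i \<le> t"
  shows "pairing (row_root x) i = row_pairing i (x mod (2 * t + 1))"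
proof (induction x)
  case 0
  then show ?case
    using assms rank_pos by (simp add: row_root_def pairing_0 row_pairing_def)
next
  case (Suc x)
  have "x mod (2 * t + 1) < 2 * t + 1"
    by (rule mod_less_divisor) simp
  then have "x mod (2 * t + 1) \<le> 2 * t"
    by linarith
  note step = row_pairing_Suc[OF this assms]
  have "Suc x mod (2 * t + 1) = (if x mod (2 * t + 1) = 2 * t then 0 else Suc (x mod (2 * t + 1)))"
    by (simp add: mod_Suc)
  then show ?case
    using Suc step by (simp only: row_root_Suc pairing_add box_root_eq)
qed

lemma reflect_row_root:
  assumes "i \<le> t"
  shows "reflect i (row_root x) = row_root x - scale (row_pairing i (x mod (2 * t + 1))) (\<alpha> i)"
  using pairing_row_root[OF assms, of x] by (simp add: reflection_def pairing_def)

section \<open>The weight as a sum over rows\<close>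

text \<open>The boxes are counted in two ways, by rows and by labels.\<close>

lemma weight_eq:
  assumes "finite \<rho>"
  shows "weight scale \<alpha> \<Lambda> (2 * t + 1) t \<rho> = \<Lambda> - (\<Sum>x\<in>\<rho>. row_root x)"
proof -
  let ?r = "\<lambda>(x, c). residue_seq t ! (c mod (2 * t + 1))"
  have Y: "young_diagram \<rho> = Sigma \<rho> (\<lambda>x. {..<x})"
    by (auto simp: young_diagram_def)
  then have fin: "finite (young_diagram \<rho>)"
    using assms by simp
  have "?r y \<in> {0..t}" for y :: "nat \<times> nat"
    using mod_less_divisor[of "2 * t + 1" "snd y"]
    by (cases y) (auto intro!: residue_seq_nth_le)
  then have r: "?r ` young_diagram \<rho> \<subseteq> {0..t}"
    by blast
  have "(\<Sum>x\<in>\<rho>. row_root x) = (\<Sum>y\<in>young_diagram \<rho>. \<alpha> (?r y))"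
    using assms by (simp add: Y row_root_def box_root_def sum.Sigma split_def)
  \<comment> \<open>Grouping by label loses no box because all labels lie in
    \<open>{0..t}\<close>.\<close>
  also have "\<dots> = (\<Sum>j=0..t. \<Sum>y\<in>{y\<in>young_diagram \<rho>. ?r y = j}. \<alpha> (?r y))"
    by (rule sum.group[OF fin _ r, symmetric]) simp
  also have "\<dots> = (\<Sum>j=0..t. \<Sum>y\<in>{y\<in>young_diagram \<rho>. ?r y = j}. \<alpha> j)"
    by (intro sum.cong) auto
  also have "\<dots> = (\<Sum>j=0..t. scale (of_nat (content (2 * t + 1) t \<rho> j)) (\<alpha> j))"
    unfolding sum_constant_scale content_def
    by (intro sum.cong arg_cong2[of _ _ _ _ scale] arg_cong[of _ _ of_nat] arg_cong[of _ _ card])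
      auto
  finally show ?thesis
    by (simp add: weight_def)
qed

section \<open>Reflections of positive index\<close>

text \<open>The box added to a row of length \<open>x\<close> is in column \<open>x\<close>, columns
  being counted from 0, so \<open>x\<close> itself determines its label.\<close>

lemma row_root_add_box:
  assumes "y = Suc x" "x mod (2 * t + 1) = i \<or> x mod (2 * t + 1) = 2 * t - i" "i \<le> t"
  shows "row_root y = row_root x + \<alpha> i"
proof -
  have "min (x mod (2 * t + 1)) (2 * t - x mod (2 * t + 1)) = i"
    using assms(2,3) by linarith
  then show ?thesis
    by (simp only: assms(1) row_root_Suc box_root_eq)
qed

text \<open>For positive \<open>i\<close> the reflection fixes \<open>\<Lambda>\<close>, so the rows
  can be compared one by one.\<close>

lemma reflect_weight_image:
  assumes "finite \<rho>" "i \<le> t" "0 < i" "inj_on f \<rho>"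
    and "\<And>x. x \<in> \<rho> \<Longrightarrow> row_root (f x) = reflect i (row_root x)"
  shows "weight scale \<alpha> \<Lambda> (2 * t + 1) t (f ` \<rho>) = reflect i (weight scale \<alpha> \<Lambda> (2 * t + 1) t \<rho>)"
  unfolding weight_eq[OF assms(1)] weight_eq[OF finite_imageI[OF assms(1)]]
  using assms by (simp add: reflect_diff reflect_sum reflect_fundamental_weight sum.reindex)

lemma row_root_move_part:
  assumes "0 < i" "i \<le> t"
    and \<sigma>: "\<sigma> = (if i < t then transpose i (i + 1) \<circ> transpose (2 * t + 1 - i) (2 * t + 1 - i - 1)
      else transpose t (t + 1))"
  shows "row_root (move_part (2 * t + 1) \<sigma> x) = reflect i (row_root x)"
proof -
  let ?p = "2 * t + 1"
  define b where "b = x mod ?p"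
  define y where "y = move_part ?p \<sigma> x"
  have x: "x = x div ?p * ?p + b" and y: "y = x div ?p * ?p + \<sigma> b"
    by (simp_all only: b_def y_def move_part_def div_mult_mod_eq)
  have "b < ?p"
    unfolding b_def by (rule mod_less_divisor) simp
  \<comment> \<open>Each exchange is between adjacent runners, so a moved row gains or loses exactly
    one box. At \<open>i = t\<close> the two pairs of runners coincide.\<close>
  have \<sigma>_cases: "\<sigma> b = (if b = i \<or> b = 2 * t - i then Suc b
     else if b = i + 1 \<or> b = 2 * t + 1 - i then b - 1 else b)"
  proof (cases "i < t")
    case True
    define q where "q = 2 * t - i"
    \<comment> \<open>The inequality makes the two transpositions disjoint.\<close>
    have q: "2 * t + 1 - i = Suc q" "2 * t - i = q" "i + 1 < q"
      using True by (auto simp: q_def)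
    show ?thesis
      unfolding \<sigma> if_P[OF True] q(1,2) using q(3) by (simp add: transpose_def)
  next
    case False
    then have "i = t"
      using assms(2) by simp
    then show ?thesis
      unfolding \<sigma> by (simp add: transpose_def)
  qed
  consider "b = i \<or> b = 2 * t - i"
    | "\<not> (b = i \<or> b = 2 * t - i)" "b = i + 1 \<or> b = 2 * t + 1 - i"
    | "\<not> (b = i \<or> b = 2 * t - i)" "\<not> (b = i + 1 \<or> b = 2 * t + 1 - i)"
    by blast
  then have "row_root y = reflect i (row_root x)"
  proof cases
    case 1
    then have "y = Suc x"
      using x y \<sigma>_cases by simp
    then have "row_root y = row_root x + \<alpha> i"
      using 1 assms by (intro row_root_add_box) (auto simp: b_def)
    moreover have "row_pairing i b = -1"
      using 1 assms by (auto simp: row_pairing_def)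
    ultimately show ?thesis
      using reflect_row_root[OF assms(2), of x] by (simp add: b_def)
  next
    case 2
    then have \<sigma>b: "\<sigma> b = b - 1" "0 < b" "b - 1 = i \<or> b - 1 = 2 * t - i"
      using \<sigma>_cases assms by auto
    \<comment> \<open>The new row is now the shorter one, so the added box is read from
      \<open>y\<close> to \<open>x\<close>.\<close>
    then have "x = Suc y"
      using x y by linarith
    have "b - 1 < ?p"
      using \<open>b < ?p\<close> by simp
    then have "y mod ?p = b - 1"
      unfolding y \<sigma>b(1) by (simp only: mod_mult_self3 mod_less)
    then have "row_root x = row_root y + \<alpha> i"
      using \<sigma>b \<open>x = Suc y\<close> assms by (intro row_root_add_box) auto
    moreover have "row_pairing i b = 1"
      using 2 assms by (auto simp: row_pairing_def)
    ultimately show ?thesis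
      using reflect_row_root[OF assms(2), of x] by (simp add: b_def)
  next
    case 3
    then have "y = x"
      using x y \<sigma>_cases by simp
    moreover have "row_pairing i b = 0"
      using 3 assms by (auto simp: row_pairing_def)
    ultimately show ?thesis
      using reflect_row_root[OF assms(2), of x] by (simp add: b_def)
  qed
  then show ?thesis
    by (simp only: y_def)
qed

section \<open>The reflection in \<alpha>_0\<close>

text \<open>The new boxes have column residues \<open>2 * t\<close> and 0, on either side of a
  multiple of \<open>p\<close>; both are labelled 0.\<close>

lemma row_root_add_2:
  assumes "x mod (2 * t + 1) = 2 * t"
  shows "row_root (x + 2) = row_root x + scale 2 (\<alpha> 0)"
proof -
  have "Suc x mod (2 * t + 1) = 0"
    using assms by (simp add: mod_Suc)
  then have "row_root (x + 2) = row_root x + \<alpha> 0 + \<alpha> 0"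
    using row_root_add_box[of "Suc x" x 0] row_root_add_box[of "x + 2" "Suc x" 0] assms by simp
  then show ?thesis
    using scale_left_distrib[of 1 1 "\<alpha> 0"] by simp
qed

text \<open>The part \<open>1\<close> is excluded: its root \<alpha>_0 reflects to -\<alpha>_0,
  which is no sum of box roots, whereas the map fixes it.\<close>

lemma row_root_swap_around_multiples:
  assumes "x \<noteq> 1"
  shows "row_root (swap_around_multiples (2 * t + 1) x) = reflect 0 (row_root x)"
proof -
  let ?p = "2 * t + 1"
  have p: "2 < ?p"
    using rank_pos by simp
  consider a where "1 \<le> a" "x = a * ?p + 1" | "x mod ?p = ?p - 1"
    | "x mod ?p \<noteq> ?p - 1" "x mod ?p \<noteq> 1"
    using mod_eq_one_iff[OF p, of x] assms by blast
  then show ?thesis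
  proof cases
    case 1
    define y where "y = a * ?p - 1"
    have "?p \<le> a * ?p"
      using 1(1) by (cases a) auto
    then have "x = y + 2"
      using 1(2) rank_pos unfolding y_def by linarith
    moreover have "y mod ?p = 2 * t"
      using mod_eq_pred_iff[OF p, of y] 1(1) y_def by auto
    ultimately have "row_root x = row_root y + scale 2 (\<alpha> 0)"
      using row_root_add_2 by blast
    moreover have "x mod ?p = 1"
      using mod_eq_one_iff[OF p, of x] 1 by blast
    moreover have "swap_around_multiples ?p x = y"
      using swap_around_multiples_simps(2)[OF p 1(1)] unfolding 1(2) y_def .
    ultimately show ?thesis
      using reflect_row_root[of 0 x] by (simp add: row_pairing_def)
  next
    case 2
    then show ?thesis
      using reflect_row_root[of 0 x] row_root_add_2[of x] rank_pos
      by (simp add: row_pairing_def swap_around_multiples_def)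
  next
    case 3
    then show ?thesis
      using reflect_row_root[of 0 x] by (simp add: row_pairing_def swap_around_multiples_def)
  qed
qed

text \<open>Let S be the sum of \<open>row_root\<close> over the parts other than \<open>1\<close>,
  and write r for the reflection. If \<open>1\<close> is a part, then r(\<Lambda> - \<alpha>_0 - S)
  = \<Lambda> - r(S), and \<open>1\<close> is removed. Otherwise r(\<Lambda> - S) = \<Lambda> -
  \<alpha>_0 - r(S), and \<open>1\<close> is added.\<close>

lemma weight_scopes_0:
  assumes "finite \<rho>"
  shows "weight scale \<alpha> \<Lambda> (2 * t + 1) t (scopes (2 * t + 1) t 0 \<rho>) =
    reflect 0 (weight scale \<alpha> \<Lambda> (2 * t + 1) t \<rho>)"
proof -
  let ?p = "2 * t + 1" and ?s = "swap_around_multiples (2 * t + 1)"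
  have p: "2 < ?p"
    using rank_pos by simp
  have row_1: "row_root 1 = \<alpha> 0"
    by (simp add: row_root_def box_root_eq)
  have reflect_1: "reflect 0 (\<alpha> 0) = - \<alpha> 0"
    using reflect_row_root[of 0 1] rank_pos scale_left_distrib[of 1 1 "\<alpha> 0"]
    by (simp add: row_1 row_pairing_def flip: row_1)
  have "?s 1 = 1"
    using p by (simp add: swap_around_multiples_def)
  \<comment> \<open>An involution fixing \<open>1\<close> sends no other part to \<open>1\<close>,
    so an inserted \<open>1\<close> contributes a new summand.\<close>
  then have not_1: "1 \<notin> ?s ` (\<rho> - {1})"
    using swap_around_multiples_involution[OF p] by (metis DiffD2 imageE singletonI)
  have rest: "(\<Sum>x\<in>?s ` (\<rho> - {1}). row_root x) = reflect 0 (\<Sum>x\<in>\<rho> - {1}. row_root x)"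
    unfolding reflect_sum sum.reindex[OF inj_swap_around_multiples[OF p]]
    by (intro sum.cong) (auto simp: row_root_swap_around_multiples simp del: One_nat_def)
  show ?thesis
  proof (cases "1 \<in> \<rho>")
    case True
    then have "(\<Sum>x\<in>\<rho>. row_root x) = \<alpha> 0 + (\<Sum>x\<in>\<rho> - {1}. row_root x)"
      using sum.remove[OF assms True, of row_root] row_1 by simp
    moreover have "scopes ?p t 0 \<rho> = ?s ` (\<rho> - {1})"
      using True by (simp only: scopes_0_eq[OF p] if_True Un_empty_right)
    moreover have "finite (?s ` (\<rho> - {1}))"
      using assms by simp
    ultimately show ?thesis
      by (simp only: weight_eq assms rest) (simp add: reflect_diff reflect_add
          reflect_fundamental_weight reflect_1)
  next
    case False
    then have \<rho>: "\<rho> - {1} = \<rho>"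
      by simp
    have fin: "finite (?s ` \<rho>)"
      using assms by simp
    have "scopes ?p t 0 \<rho> = insert 1 (?s ` \<rho>)"
      using False by (simp only: scopes_0_eq[OF p] if_False \<rho>) simp
    moreover have "(\<Sum>x\<in>insert 1 (?s ` \<rho>). row_root x) = \<alpha> 0 + reflect 0 (\<Sum>x\<in>\<rho>. row_root x)"
      using not_1 rest row_1 unfolding \<rho> by (simp only: sum.insert[OF fin] not_False_eq_True)
    ultimately show ?thesis
      by (simp only: weight_eq assms fin finite_insert) (simp add: reflect_diff
          reflect_fundamental_weight)
  qed
qed

section \<open>All simple reflections\<close>

lemma weight_scopes:
  assumes "finite \<rho>" "i \<le> t"
  shows "weight scale \<alpha> \<Lambda> (2 * t + 1) t (scopes (2 * t + 1) t i \<rho>) =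
    reflect i (weight scale \<alpha> \<Lambda> (2 * t + 1) t \<rho>)"
proof (cases "i = 0")
  case True
  then show ?thesis
    using weight_scopes_0[OF assms(1)] by simp
next
  case False
  let ?p = "2 * t + 1"
  define \<sigma> where "\<sigma> = (if i < t then transpose i (i + 1) \<circ> transpose (?p - i) (?p - i - 1)
    else transpose t (t + 1))"
  have "scopes ?p t i \<rho> = permute_runners ?p \<sigma> \<rho>"
    using False by (simp add: scopes_def \<sigma>_def)
  then have image: "scopes ?p t i \<rho> = move_part ?p \<sigma> ` \<rho>"
    by (simp add: permute_runners_eq_image)
  have "inj \<sigma>"
    unfolding \<sigma>_def by (auto intro!: inj_compose)
  moreover have transpose_less: "transpose x y z < ?p" if "x < ?p" "y < ?p" "z < ?p" for x y z
    using that unfolding transpose_def by presburger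
  \<comment> \<open>Together with injectivity of \<open>\<sigma>\<close> this keeps the moved parts
    distinct, as the reindexing requires.\<close>
  have "\<sigma> b < ?p" if "b < ?p" for b
  proof (cases "i < t")
    case True
    then show ?thesis
      unfolding \<sigma>_def if_P[OF True] o_apply using that False by (intro transpose_less) auto
  next
    case False
    then show ?thesis
      unfolding \<sigma>_def if_not_P[OF False] using that rank_pos by (intro transpose_less) auto
  qed
  ultimately have "inj_on (move_part ?p \<sigma>) \<rho>"
    by (intro inj_move_part) auto
  then show ?thesis
    unfolding image using assms False row_root_move_part[OF _ assms(2) \<sigma>_def]
    by (intro reflect_weight_image) auto
qed

end

theorem corollary6p1p1:
  fixes scale :: "'k::field_char_0 \<Rightarrow> 'v::ab_group_add \<Rightarrow> 'v"
    and form :: "'v \<Rightarrow> 'v \<Rightarrow> 'k"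
    and \<alpha> :: "nat \<Rightarrow> 'v"
    and \<Lambda> :: 'v
    and p t i :: nat
    and \<rho> :: "nat set"
  assumes "prime p" and "odd p" and "t = (p - 1) div 2"
    and "twisted_affine_A2 scale form t \<alpha> \<Lambda>"
    and "bar_core p \<rho>"
    and "i \<le> t"
  shows "weight scale \<alpha> \<Lambda> p t (scopes p t i \<rho>)
         = reflection scale form (\<alpha> i) (weight scale \<alpha> \<Lambda> p t \<rho>)"
proof -
  \<comment> \<open>Oddness makes the halving exact and gives the period of the labelling.\<close>
  have p: "p = 2 * t + 1"
    using assms(2,3) by presburger
  have "finite \<rho>"
    using assms(5) by (simp add: bar_core_def strict_partition_def)
  then show ?thesis
    unfolding p by (rule twisted_affine_A2.weight_scopes[OF assms(4) _ assms(6)])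
qed

end
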